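(* Let $F=\mathbb{F}_{2^r}$. (1) If $(F,+,* )$ is a commutative presemifield whose multiplication is $x*y=xy+\sum_{0\le i<j\le r-1}a_{ij}(x^{2^i}y^{2^j}+x^{2^j}y^{2^i})$ with $a_{ij}\in F$, then $f(x)=\sum_{i<j}a_{ij}x^{2^i+2^j}$ is a pseudo-planar function and $x*y=xy+f(x+y)+f(x)+f(y)$ for all $x,y\in F$. (2) If $(F,+,* )$ is a commutative presemifield, then there exist a commutative presemifield $(F,+,\star)$ strongly isotopic to $(F,+,* )$ and a pseudo-planar function $f:F\to F$ such that $x\star y=xy+f(x+y)+f(x)+f(y)$ for all $x,y\in F$. (3) Let $f:F\to F$ be pseudo-planar. Then $(F,+,* )$ with $x*y=xy+f(x+y)+f(x)+f(y)$ is a presemifield if and only if $f$ is quadratic.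
   Context: A presemifield $(F,+,* )$ is the additive group of $F$ with a multiplication $*$ that is left and right distributive over $+$ and has no zero divisors; commutative means $x*y=y*x$. Two presemifields $(F,+,* )$, $(F,+,\star)$ are strongly isotopic if there are bijective additive maps $L,M:F\to F$ with $L(x*y)=M(x)\star M(y)$ for all $x,y$. A function $f:F\to F$ is pseudo-planar if for each $a\in F^*$ the map $x\mapsto f(x+a)+f(x)+ax$ is a permutation of $F$. Here $f$ is called quadratic if $f(x+y+z)+f(x+y)+f(x+z)+f(y+z)+f(x)+f(y)+f(z)=0$ for all $x,y,z\in F$. *)

theory Defs
  imports Complex_Main "HOL-Library.Cardinality"
begin

(* The additive group is that of the type; only the multiplication is a parameter. *)
locale presemifield =
  fixes mult :: "'a::ab_group_add \<Rightarrow> 'a \<Rightarrow> 'a"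
  assumes add_right: "mult x (y + z) = mult x y + mult x z"
    and add_left: "mult (x + y) z = mult x z + mult y z"
    and no_zero_div: "mult x y = 0 \<Longrightarrow> x = 0 \<or> y = 0"

locale comm_presemifield = presemifield +
  assumes commute: "mult x y = mult y x"

definition strongly_isotopic ::
    "('a::ab_group_add \<Rightarrow> 'a \<Rightarrow> 'a) \<Rightarrow> ('a \<Rightarrow> 'a \<Rightarrow> 'a) \<Rightarrow> bool" where
  "strongly_isotopic mult star \<longleftrightarrow>
     (\<exists>L M. bij L \<and> additive L \<and> bij M \<and> additive M \<and>
       (\<forall>x y. L (mult x y) = star (M x) (M y)))"

(* Meant for fields of characteristic 2, where + and - coincide. *)
definition pseudo_planar :: "('a::field \<Rightarrow> 'a) \<Rightarrow> bool" where
  "pseudo_planar f \<longleftrightarrow> (\<forall>a. a \<noteq> 0 \<longrightarrow> bij (\<lambda>x. f (x + a) + f x + a * x))"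

definition quadratic :: "('a::field \<Rightarrow> 'a) \<Rightarrow> bool" where
  "quadratic f \<longleftrightarrow>
     (\<forall>x y z. f (x + y + z) + f (x + y) + f (x + z) + f (y + z) + f x + f y + f z = 0)"

end

theory Submission
  imports Defs
begin

text \<open>
  In characteristic 2 a commutative product satisfies \<open>(x + y) * (x + y) = x * x + y * y\<close>, so the
  diagonal map \<open>x \<mapsto> x * x\<close> is additive, and injective as there are no zero divisors. Composing the
  product with the additive bijection taking \<open>x * x\<close> to the field square \<open>x\<^sup>2\<close> leaves a product
  whose difference from \<open>x y\<close> is alternating, and over the field with two elements every
  alternating form is the polarization of some \<open>f\<close>. Pseudo-planarity of \<open>f\<close> and the absence of
  zero divisors are then the same condition, since \<open>f (x + a) + f x + a x\<close> is \<open>x * a\<close> plus a constant.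
\<close>

section \<open>Arithmetic in characteristic 2\<close>

text \<open>Translation by 1 permutes the field, so summing all elements before and after it gives
  \<open>2 ^ r = 0\<close> in the field, and a field has no nonzero nilpotents.\<close>

lemma two_eq_zero_if_card:
  assumes "CARD('a::{field,finite}) = 2 ^ r"
  shows "(2::'a) = 0"
proof -
  have "(\<Sum>x\<in>UNIV. x::'a) = (\<Sum>x\<in>UNIV. x + 1)"
    by (rule sum.reindex_bij_witness[of _ "\<lambda>x. x + 1" "\<lambda>x. x - 1"]) auto
  then have "of_nat CARD('a) = (0::'a)"
    by (simp add: sum.distrib)
  with assms show ?thesis
    by simp
qed

lemma double_eq_zero:
  assumes "(2::'a::ring_1) = 0"
  shows "x + x = (0::'a)"
  using assms by (metis mult_2 mult_zero_left)

lemma double_cancel_left: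
  assumes "(2::'a::ring_1) = 0"
  shows "x + (x + y) = (y::'a)"
  using double_eq_zero[OF assms, of x] by (metis add.assoc add_0)

lemma frobenius_add:
  assumes "(2::'a::comm_ring_1) = 0"
  shows "(x + y) ^ 2 ^ n = x ^ 2 ^ n + (y::'a) ^ 2 ^ n"
proof (induction n)
  case (Suc n)
  then show ?case
    using assms by (simp add: power_mult mult.commute[of 2] power2_sum)
qed simp

section \<open>Alternating forms as polarizations\<close>

text \<open>Instead of choosing a basis, \<open>f\<close> is extended along a chain of subgroups,
  each step passing from \<open>H\<close> to the union of \<open>H\<close> and one further coset
  \<open>a + H\<close>.\<close>

lemma alternating_form_is_polarization:
  fixes B :: "'a::{ab_group_add,finite} \<Rightarrow> 'a \<Rightarrow> 'b::ab_group_add"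
  assumes two: "\<And>x::'a. x + x = 0"
    and addl: "\<And>x y z. B (x + y) z = B x z + B y z"
    and addr: "\<And>x y z. B x (y + z) = B x y + B x z"
    and alt: "\<And>x. B x x = 0"
  shows "\<exists>f. \<forall>x y. f (x + y) = f x + f y + B x y"
proof -
  have B0: "B 0 y = 0" for y
    using addl[of 0 0 y] by simp
  have Btwo: "B x y + B x y = 0" for x y
    using addl[of x x y] two[of x] B0 by simp
  have "B x y + B y x = 0" for x y
    using alt[of "x + y"] by (simp only: addl addr) (simp add: alt ac_simps)
  then have sym: "B x y = B y x" for x y
    using Btwo[of x y] by (metis add_left_imp_eq)
  have tc: "x + (x + y) = y" for x y :: 'a
    using two[of x] by (metis add.assoc add_0)
  \<comment> \<open>The induction set \<open>A\<close> need not be a subgroup; it only has to lie in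
    a subgroup \<open>H\<close> on which \<open>f\<close> already works. Taking
    \<open>A = UNIV\<close> forces \<open>H = UNIV\<close>.\<close>
  have "\<exists>H f. A \<subseteq> H \<and> 0 \<in> H \<and> (\<forall>x\<in>H. \<forall>y\<in>H. x + y \<in> H) \<and>
      (\<forall>x\<in>H. \<forall>y\<in>H. f (x + y) = f x + f y + B x y)" if "finite A" for A :: "'a set"
    using that
  proof (induction A)
    case empty
    show ?case
      by (rule exI[of _ "{0}"], rule exI[of _ "\<lambda>_. 0"]) (simp add: B0)
  next
    case (insert a A)
    then obtain H f where H: "A \<subseteq> H" "0 \<in> H" "\<forall>x\<in>H. \<forall>y\<in>H. x + y \<in> H"
      and f: "\<forall>x\<in>H. \<forall>y\<in>H. f (x + y) = f x + f y + B x y"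
      by (elim exE conjE)
    note H = H(1,2) H(3)[rule_format] and f = f[rule_format]
    show ?case
    proof (cases "a \<in> H")
      case True
      with H f show ?thesis by (intro exI[of _ H] exI[of _ f]) simp
    next
      case False
      define K where "K = H \<union> (\<lambda>h. a + h) ` H"
      \<comment> \<open>Prescribing the value 0 at \<open>a\<close> forces the value
        \<open>f h + B h a\<close> at \<open>a + h\<close>; on the new coset, \<open>h\<close> is
        recovered from \<open>x = a + h\<close> as \<open>a + x\<close>. Values outside
        \<open>K\<close> are irrelevant.\<close>
      define g where "g x = (if x \<in> H then f x else f (a + x) + B (a + x) a)" for x
      have notin: "a + h \<notin> H" if "h \<in> H" for h
        using H(3)[OF _ that, of "a + h"] False by (metis add.commute tc)
      have gH: "g h = f h" if "h \<in> H" for h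
        using that by (simp add: g_def)
      have ga: "g (a + h) = f h + B h a" if "h \<in> H" for h
        using notin[OF that] by (simp add: g_def tc)
      have *: "(a + h) + (a + k) = h + k" "h + (a + k) = a + (h + k)"
              "(a + h) + k = a + (h + k)" for h k
        using tc[of a "h + k"] by (simp_all only: ac_simps)
      have K: "x + y \<in> K" if "x \<in> K" "y \<in> K" for x y
      proof -
        have mem_K: "z \<in> K \<longleftrightarrow> z \<in> H \<or> a + z \<in> H" for z
          unfolding K_def by (metis Un_iff imageE imageI tc)
        show ?thesis
          using that H(3)[of x y] H(3)[of "a + x" y] H(3)[of x "a + y"] H(3)[of "a + x" "a + y"]
          by (auto simp: mem_K tc two ac_simps)
      qed
      have Btc: "B x y + (B x y + z) = z" for x y z
        using Btwo[of x y] by (metis add.assoc add_0)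
      have "g (x + y) = g x + g y + B x y" if xy: "x \<in> K" "y \<in> K" for x y
      proof -
        consider h k where "h \<in> H" "k \<in> H" "x = h" "y = k"
          | h k where "h \<in> H" "k \<in> H" "x = a + h" "y = k"
          | h k where "h \<in> H" "k \<in> H" "x = h" "y = a + k"
          | h k where "h \<in> H" "k \<in> H" "x = a + h" "y = a + k"
          using xy by (auto simp: K_def)
        then show ?thesis
        proof cases
          case (1 h k)
          then show ?thesis by (simp add: gH H(3) f)
        next
          case (2 h k)
          then have "g (x + y) = f (h + k) + B (h + k) a"
            by (simp only: *(3) ga H(3))
          with 2 show ?thesis
            by (simp add: ga gH f addl addr sym[of a] ac_simps)
        next
          case (3 h k)
          then have "g (x + y) = f (h + k) + B (h + k) a"
            by (simp only: *(2) ga H(3))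
          with 3 show ?thesis
            by (simp add: ga gH f addl addr ac_simps)
        next
          case (4 h k)
          then have "g (x + y) = f (h + k)"
            by (simp only: *(1) gH H(3))
          \<comment> \<open>The terms \<open>B h a\<close> and \<open>B k a\<close> occur once in
            \<open>g x + g y\<close> and once, up to symmetry, in \<open>B x y\<close>, so they
            cancel; \<open>B a a\<close> vanishes.\<close>
          with 4 show ?thesis
            by (simp add: ga f addl addr alt sym[of a] ac_simps Btc Btwo)
        qed
      qed
      moreover have "insert a A \<subseteq> K" "0 \<in> K"
        using H(1,2) by (force simp: K_def)+
      ultimately show ?thesis
        using K by (intro exI[of _ K] exI[of _ g]) simp
    qed
  qed
  from this[of UNIV] show ?thesis
    by (auto simp: top.extremum_unique)
qed

section \<open>Pseudo-planarity from the absence of zero divisors\<close>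

context presemifield
begin

lemma inj_mult_right:
  assumes "a \<noteq> 0"
  shows "inj (\<lambda>x. mult x a)"
proof (rule injI)
  fix x y assume "mult x a = mult y a"
  then have "mult (x - y) a = 0"
    using add_left[of "x - y" y a] by simp
  with assms no_zero_div show "x = y" by force
qed

end

lemma pseudo_planar_if_presemifield:
  fixes f :: "'a::{field,finite} \<Rightarrow> 'a"
  assumes two: "(2::'a) = 0" and "presemifield mult"
    and mult: "\<And>x y. mult x y = x * y + f (x + y) + f x + f y"
  shows "pseudo_planar f"
proof -
  interpret presemifield mult by fact
  have "inj (\<lambda>x. f (x + a) + f x + a * x)" if "a \<noteq> 0" for a
  proof -
    \<comment> \<open>The product \<open>mult x a\<close> contains \<open>f a\<close> as well, and
      the two copies cancel.\<close>
    have "(\<lambda>x. f (x + a) + f x + a * x) = (\<lambda>x. f a + mult x a)"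
      by (simp add: mult fun_eq_iff ac_simps double_cancel_left[OF two] double_eq_zero[OF two])
    then show ?thesis
      using inj_mult_right[OF that] by (simp add: inj_def)
  qed
  then show ?thesis
    by (simp add: pseudo_planar_def bij_def finite_UNIV_inj_surj)
qed

text \<open>Each monomial is a product of two Frobenius powers, which are additive. Expanding it at
  \<open>x + y\<close> gives the two mixed terms and the two pure ones, and \<open>f x + f y\<close>
  cancels the latter.\<close>

lemma polarization_of_dembowski_ostrom:
  fixes a :: "nat \<Rightarrow> nat \<Rightarrow> 'a::comm_ring_1" and x y :: 'a
  assumes two: "(2::'a) = 0" and f: "f = (\<lambda>x. \<Sum>j<r. \<Sum>i<j. a i j * x ^ (2 ^ i + 2 ^ j))"
  shows "f (x + y) + f x + f y =
    (\<Sum>j<r. \<Sum>i<j. a i j * (x ^ 2 ^ i * y ^ 2 ^ j + x ^ 2 ^ j * y ^ 2 ^ i))"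
  unfolding f sum.distrib[symmetric]
proof (intro sum.cong refl)
  fix i j
  define p q where "p = a i j * (x ^ 2 ^ i * x ^ 2 ^ j)" and "q = a i j * (y ^ 2 ^ i * y ^ 2 ^ j)"
  have "p + p = 0" "q + q = 0"
    by (simp_all only: double_eq_zero[OF two])
  moreover have "a i j * (x + y) ^ (2 ^ i + 2 ^ j) + a i j * x ^ (2 ^ i + 2 ^ j)
        + a i j * y ^ (2 ^ i + 2 ^ j)
      = a i j * (x ^ 2 ^ i * y ^ 2 ^ j + x ^ 2 ^ j * y ^ 2 ^ i) + (p + p) + (q + q)"
    by (simp add: p_def q_def power_add frobenius_add[OF two] algebra_simps)
  ultimately show "a i j * (x + y) ^ (2 ^ i + 2 ^ j) + a i j * x ^ (2 ^ i + 2 ^ j)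
        + a i j * y ^ (2 ^ i + 2 ^ j)
      = a i j * (x ^ 2 ^ i * y ^ 2 ^ j + x ^ 2 ^ j * y ^ 2 ^ i)"
    by simp
qed

lemma pseudo_planar_if_comm_presemifield:
  fixes f :: "'a::{field,finite} \<Rightarrow> 'a"
  assumes "(2::'a) = 0" "comm_presemifield mult"
    and "\<And>x y. mult x y = x * y + f (x + y) + f x + f y"
  shows "pseudo_planar f"
  using assms comm_presemifield.axioms(1) pseudo_planar_if_presemifield by blast

section \<open>Normalizing the diagonal by a strong isotopism\<close>

text \<open>Commutativity makes the two cross terms equal, so they cancel. The lemma serves both the
  given product and the field product, whose diagonal is the Frobenius map.\<close>

lemma bij_additive_diagonal:
  fixes mult :: "'a::{ab_group_add,finite} \<Rightarrow> 'a \<Rightarrow> 'a"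
  assumes two: "\<And>x::'a. x + x = 0" and "comm_presemifield mult"
  shows "additive (\<lambda>x. mult x x)" and "bij (\<lambda>x. mult x x)"
proof -
  interpret comm_presemifield mult by fact
  have add: "mult (x + y) (x + y) = mult x x + mult y y" for x y
  proof -
    have "mult (x + y) (x + y) = mult x x + mult y y + (mult x y + mult x y)"
      by (simp add: add_left add_right commute[of y x] ac_simps)
    then show ?thesis
      by (simp add: two)
  qed
  then show "additive (\<lambda>x. mult x x)"
    by unfold_locales
  have "inj (\<lambda>x. mult x x)"
  proof (rule injI)
    fix x y assume "mult x x = mult y y"
    then have "mult (x - y) (x - y) = 0"
      using add[of "x - y" y] by simp
    with no_zero_div show "x = y" by force
  qed
  then show "bij (\<lambda>x. mult x x)"
    by (simp add: bij_def finite_UNIV_inj_surj)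
qed

lemma comm_presemifield_field: "comm_presemifield ((*) :: 'a::field \<Rightarrow> _)"
  by unfold_locales (simp_all add: algebra_simps)

lemma additive_inv:
  assumes "additive g" "bij g"
  shows "additive (inv g)"
proof
  fix x y
  interpret additive g by fact
  have "g (inv g x + inv g y) = x + y"
    using \<open>bij g\<close> by (simp add: add bij_is_surj surj_f_inv_f)
  then show "inv g (x + y) = inv g x + inv g y"
    using \<open>bij g\<close> by (metis bij_is_inj inv_f_f)
qed

lemma additive_comp:
  assumes "additive g" "additive h"
  shows "additive (g \<circ> h)"
  using assms by (simp add: additive_def)

lemma comm_presemifield_comp:
  assumes "additive S" "inj S" "comm_presemifield mult"
  shows "comm_presemifield (\<lambda>x y. S (mult x y))"
proof -
  interpret additive S by fact
  interpret comm_presemifield mult by fact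
  show ?thesis
  proof
    fix x y z
    show "S (mult x (y + z)) = S (mult x y) + S (mult x z)"
      by (simp add: add add_right)
    show "S (mult (x + y) z) = S (mult x z) + S (mult y z)"
      by (simp add: add add_left)
    show "S (mult x y) = S (mult y x)"
      by (simp add: commute)
    assume "S (mult x y) = 0"
    then have "mult x y = 0"
      using zero \<open>inj S\<close> by (metis injD)
    then show "x = 0 \<or> y = 0"
      by (rule no_zero_div)
  qed
qed

lemma strongly_isotopic_pseudo_planar:
  fixes mult :: "'a::{field,finite} \<Rightarrow> 'a \<Rightarrow> 'a"
  assumes two: "(2::'a) = 0" and m: "comm_presemifield mult"
  shows "\<exists>star f. comm_presemifield star \<and> strongly_isotopic star mult \<and> pseudo_planar f \<and>
           (\<forall>x y. star x y = x * y + f (x + y) + f x + f y)"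
proof -
  note dbl = double_eq_zero[OF two]
  let ?q = "\<lambda>x. mult x x" and ?s = "\<lambda>x::'a. x * x"
  note q = bij_additive_diagonal[OF dbl m]
  note s = bij_additive_diagonal[OF dbl comm_presemifield_field]
  \<comment> \<open>\<open>S\<close> is chosen to send \<open>mult x x\<close> to
    \<open>x * x\<close>, so that \<open>star\<close> and the field product agree on the
    diagonal.\<close>
  define S where "S = ?s \<circ> inv ?q"
  have S: "additive S" "bij S"
    unfolding S_def by (intro additive_comp s additive_inv q bij_comp bij_imp_bij_inv)+
  have Sq: "S (mult x x) = x * x" for x
    using inv_f_f[OF bij_is_inj[OF q(2)], of x] by (simp add: S_def)
  define star where "star x y = S (mult x y)" for x y
  interpret star: comm_presemifield star
    unfolding star_def by (rule comm_presemifield_comp[OF S(1) bij_is_inj[OF S(2)] m])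
  have "strongly_isotopic star mult"
    unfolding strongly_isotopic_def
  proof (intro exI conjI allI)
    \<comment> \<open>Only the values of the product are changed, so \<open>inv S\<close> serves as
      \<open>L\<close> and the identity as \<open>M\<close>.\<close>
    show "bij (inv S)" "additive (inv S)"
      using S by (auto intro: bij_imp_bij_inv additive_inv)
    show "bij (\<lambda>x::'a. x)" "additive (\<lambda>x::'a. x)"
      by (auto simp: additive_def bij_def)
    show "inv S (star x y) = mult x y" for x y
      using S(2) by (simp add: star_def bij_is_inj)
  qed
  moreover have "\<exists>f. \<forall>x y. f (x + y) = f x + f y + (star x y - x * y)"
  proof (rule alternating_form_is_polarization)
    show "star x x - x * x = 0" for x
      by (simp add: star_def Sq)
  qed (simp_all add: dbl star.add_left star.add_right algebra_simps)
  then obtain f where "\<And>x y. f (x + y) = f x + f y + (star x y - x * y)"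
    by blast
  then have f: "star x y = x * y + f (x + y) + f x + f y" for x y
    by (simp add: double_cancel_left[OF two] dbl algebra_simps)
  moreover have "pseudo_planar f"
    using two star.comm_presemifield_axioms f by (rule pseudo_planar_if_comm_presemifield)
  ultimately show ?thesis
    using star.comm_presemifield_axioms by blast
qed

section \<open>Distributivity and quadratic functions\<close>

text \<open>Once the field products and repeated values of \<open>f\<close> cancel, distributivity
  at \<open>x\<close>, \<open>y\<close>, \<open>z\<close> is exactly the quadratic identity there.
  Pseudo-planarity then excludes zero divisors.\<close>

lemma presemifield_iff_quadratic:
  fixes f :: "'a::field \<Rightarrow> 'a"
  assumes two: "(2::'a) = 0" and f: "pseudo_planar f"
  shows "presemifield (\<lambda>x y. x * y + f (x + y) + f x + f y) \<longleftrightarrow> quadratic f"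
    (is "presemifield ?m \<longleftrightarrow> _")
proof -
  note char2 = double_cancel_left[OF two] double_eq_zero[OF two]
  have eq_iff: "u = v \<longleftrightarrow> u + v = 0" for u v :: 'a
    using char2 by metis
  have add: "?m x (y + z) = ?m x y + ?m x z \<longleftrightarrow>
      f (x + y + z) + f (x + y) + f (x + z) + f (y + z) + f x + f y + f z = 0" for x y z
    unfolding eq_iff[of "?m x (y + z)"] by (simp add: char2 ac_simps distrib_left)
  show ?thesis
  proof
    assume "presemifield ?m"
    then show "quadratic f"
      unfolding quadratic_def add[symmetric] by (intro allI) (rule presemifield.add_right)
  next
    assume q: "quadratic f"
    have f0: "f 0 = 0"
      \<comment> \<open>At the origin the identity is a sum of seven copies of \<open>f 0\<close>,
        an odd number.\<close>
      using q[unfolded quadratic_def, rule_format, of 0 0 0] by (simp add: char2 ac_simps)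
    have right: "?m x (y + z) = ?m x y + ?m x z" for x y z
      using q unfolding quadratic_def add by blast
    have comm: "?m x y = ?m y x" for x y
      by (simp add: ac_simps)
    show "presemifield ?m"
    proof
      fix x y z
      show "?m x (y + z) = ?m x y + ?m x z"
        by (rule right)
      show "?m (x + y) z = ?m x z + ?m y z"
        using right[of z x y] unfolding comm[of z] .
      assume m0: "?m x y = 0"
      show "x = 0 \<or> y = 0"
      proof (rule disjCI)
        assume "y \<noteq> 0"
        then have "inj (\<lambda>x. f (x + y) + f x + y * x)"
          using f by (auto simp: pseudo_planar_def bij_def)
        \<comment> \<open>As \<open>f 0 = 0\<close>, the right-hand side is \<open>f y\<close>, and
          \<open>m0\<close> says that the left-hand side is \<open>f y\<close> too. So the injective
          map takes the same value at \<open>x\<close> and at 0.\<close>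
        moreover have "f (x + y) + f x + y * x = f (0 + y) + f 0 + y * 0"
          using m0 f0 by (subst eq_iff) (simp add: ac_simps)
        ultimately show "x = 0"
          by (rule injD)
      qed
    qed
  qed
qed

theorem theorem5p2:
  fixes r :: nat
  assumes "CARD('a::{field,finite}) = 2 ^ r"
  shows
    "(\<forall>(a :: nat \<Rightarrow> nat \<Rightarrow> 'a) mult f.
        comm_presemifield mult \<longrightarrow>
        (\<forall>x y. mult x y = x * y +
           (\<Sum>j<r. \<Sum>i<j. a i j * (x ^ 2 ^ i * y ^ 2 ^ j + x ^ 2 ^ j * y ^ 2 ^ i))) \<longrightarrow>
        f = (\<lambda>x. \<Sum>j<r. \<Sum>i<j. a i j * x ^ (2 ^ i + 2 ^ j)) \<longrightarrow>
        pseudo_planar f \<and> (\<forall>x y. mult x y = x * y + f (x + y) + f x + f y))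
     \<and> (\<forall>mult :: 'a \<Rightarrow> 'a \<Rightarrow> 'a.
        comm_presemifield mult \<longrightarrow>
        (\<exists>star f. comm_presemifield star \<and> strongly_isotopic star mult \<and> pseudo_planar f \<and>
           (\<forall>x y. star x y = x * y + f (x + y) + f x + f y)))
     \<and> (\<forall>f :: 'a \<Rightarrow> 'a. pseudo_planar f \<longrightarrow>
        (presemifield (\<lambda>x y. x * y + f (x + y) + f x + f y) \<longleftrightarrow> quadratic f))"
proof (intro conjI allI impI)
  have two: "(2::'a) = 0"
    by (rule two_eq_zero_if_card[OF assms])
  {
    fix a :: "nat \<Rightarrow> nat \<Rightarrow> 'a" and mult f
    assume m: "comm_presemifield mult"
      and mult: "\<forall>x y. mult x y = x * y +
           (\<Sum>j<r. \<Sum>i<j. a i j * (x ^ 2 ^ i * y ^ 2 ^ j + x ^ 2 ^ j * y ^ 2 ^ i))"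
      and f: "f = (\<lambda>x. \<Sum>j<r. \<Sum>i<j. a i j * x ^ (2 ^ i + 2 ^ j))"
    show mf: "mult x y = x * y + f (x + y) + f x + f y" for x y
      unfolding mult[rule_format] polarization_of_dembowski_ostrom[OF two f, symmetric]
      by (simp only: add.assoc)
    show "pseudo_planar f"
      using two m mf by (rule pseudo_planar_if_comm_presemifield)
  }
  show "\<exists>star f. comm_presemifield star \<and> strongly_isotopic star mult \<and> pseudo_planar f \<and>
      (\<forall>x y. star x y = x * y + f (x + y) + f x + f y)"
    if "comm_presemifield mult" for mult :: "'a \<Rightarrow> 'a \<Rightarrow> 'a"
    using two that by (rule strongly_isotopic_pseudo_planar)
  show "presemifield (\<lambda>x y. x * y + f (x + y) + f x + f y) \<longleftrightarrow> quadratic f"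
    if "pseudo_planar f" for f :: "'a \<Rightarrow> 'a"
    using two that by (rule presemifield_iff_quadratic)
qed

end
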